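(* Let $d$ and $D$ be positive integers with $d<D$. If $G$ is an $n$-vertex connected graph with minimum degree $d$ and maximum degree $D$, then $$R(G)\ \le\ \frac n2-\sum_{i=d}^{D-1}\frac12\left(\frac{1}{\sqrt{i}}-\frac{1}{\sqrt{i+1}}\right)^2.$$ Equality holds only for $G\in\mathcal F$.
   Context: For a graph $G$ and a vertex $v$, $d(v)$ denotes the degree of $v$. The Randić index of $G$ is $R(G)=\sum_{uv\in E(G)}\frac{1}{\sqrt{d(u)d(v)}}$. For a graph $H$ with minimum degree $d$ and maximum degree $D$ and for each integer $i\in[d,D]$, let $V_i(H)$ be the set of vertices of degree $i$ in $H$. The family $\mathcal F$ consists of all graphs $H$ with minimum degree $d$ and maximum degree $D$ such that for every integer $i\in[d,D-1]$, there exists only one vertex in $V_i(H)$ having exactly one neighbor in $V_{i+1}(H)$. *)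

theory Defs
  imports Complex_Main "Graph_Theory.Graph_Theory"
begin

text \<open>
  Finite simple graphs are represented as in \<^theory>\<open>Graph_Theory.Pair_Digraph\<close>: the locale
  \<^locale>\<open>pair_graph\<close> describes finite, symmetric, loop-free sets of arcs, where an undirected
  edge $uv$ is the pair of arcs $(u,v)$, $(v,u)$. Hence the degree of a vertex is its out-degree.
\<close>

definition neighbours :: "'a pair_pre_digraph \<Rightarrow> 'a \<Rightarrow> 'a set" where
  "neighbours G v = {w. (v, w) \<in> parcs G}"

definition vdegree :: "'a pair_pre_digraph \<Rightarrow> 'a \<Rightarrow> nat" where
  "vdegree G v = out_degree (with_proj G) v"

definition min_degree :: "'a pair_pre_digraph \<Rightarrow> nat" where
  "min_degree G = Min (vdegree G ` pverts G)"

definition max_degree :: "'a pair_pre_digraph \<Rightarrow> nat" where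
  "max_degree G = Max (vdegree G ` pverts G)"

definition uedges :: "'a pair_pre_digraph \<Rightarrow> 'a set set" where
  "uedges G = {{u, v} | u v. (u, v) \<in> parcs G}"

text \<open>
  Each undirected edge is counted once; since there are no loops, the product over the edge
  $\{u,v\}$ is $d(u)\,d(v)$.
\<close>

definition randic_index :: "'a pair_pre_digraph \<Rightarrow> real" where
  "randic_index G = (\<Sum>e\<in>uedges G. 1 / sqrt (\<Prod>w\<in>e. real (vdegree G w)))"

definition verts_of_degree :: "'a pair_pre_digraph \<Rightarrow> nat \<Rightarrow> 'a set" where
  "verts_of_degree G i = {v \<in> pverts G. vdegree G v = i}"

text \<open>
  The vertex set is required to be nonempty because \<^const>\<open>Min\<close> and \<^const>\<open>Max\<close> of the empty
  set are unspecified.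
\<close>

definition extremal_family :: "nat \<Rightarrow> nat \<Rightarrow> 'a pair_pre_digraph set" where
  "extremal_family d D = {H. pair_graph H \<and> pverts H \<noteq> {} \<and>
     min_degree H = d \<and> max_degree H = D \<and>
     (\<forall>i\<in>{d..D-1}. \<exists>!v. v \<in> verts_of_degree H i \<and>
        card (neighbours H v \<inter> verts_of_degree H (i + 1)) = 1)}"

end

theory Submission
  imports Defs
begin

text \<open>
  Writing $x_v = 1/\sqrt{d(v)}$, summation of $(x_u - x_v)^2$ over the edges gives
  $R(G) = n/2 - \frac12 \sum_{uv} (x_u - x_v)^2$. The square of a sum of positive numbers is at
  least the sum of their squares, so an edge between degrees $a < b$ contributes at least
  $\sum_{a \le i < b} (1/\sqrt i - 1/\sqrt{i+1})^2$, with strict inequality unless $b = a + 1$. By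
  connectedness each level $i$ is crossed by some edge. In the case of equality every level is
  crossed by exactly one edge, and that edge joins $V_i$ to $V_{i+1}$.
\<close>

text \<open>Extending the range from \<open>b\<close> to \<open>Suc b\<close> adds to the squared
  total, besides the new square, the mixed term
  \<open>2 * ((y a - y b) * (y b - y (Suc b)))\<close>. It is positive once \<open>a < b\<close>,
  which gives strictness from two steps on.\<close>

lemma sum_squared_steps:
  fixes y :: "nat \<Rightarrow> real"
  assumes "a < b" and "strict_antimono_on {a..b} y"
  shows "(\<Sum>i=a..<b. (y i - y (Suc i))\<^sup>2) \<le> (y a - y b)\<^sup>2 \<and>
         (Suc a < b \<longrightarrow> (\<Sum>i=a..<b. (y i - y (Suc i))\<^sup>2) < (y a - y b)\<^sup>2)"
  using assms
proof (induction b)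
  case 0
  then show ?case by simp
next
  case (Suc b)
  show ?case
  proof (cases "a = b")
    case True
    then show ?thesis by simp
  next
    case False
    with Suc.prems have ab: "a < b" by simp
    have "strict_antimono_on {a..b} y"
      using Suc.prems(2) by (rule monotone_on_subset) auto
    with Suc.IH ab have IH: "(\<Sum>i=a..<b. (y i - y (Suc i))\<^sup>2) \<le> (y a - y b)\<^sup>2"
      by blast
    have "y b < y a" "y (Suc b) < y b"
      using Suc.prems(2) ab by (auto simp: monotone_on_def)
    then have "0 < (y a - y b) * (y b - y (Suc b))"
      by simp
    moreover have "(y a - y (Suc b))\<^sup>2
        = (y a - y b)\<^sup>2 + (y b - y (Suc b))\<^sup>2 + 2 * ((y a - y b) * (y b - y (Suc b)))"
      by (simp add: power2_eq_square algebra_simps)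
    ultimately show ?thesis
      using IH ab by simp
  qed
qed

text \<open>Index 0 must be kept out: there \<open>1 / sqrt 0\<close> is 0 and not a largest
  value.\<close>

lemma strict_antimono_inverse_sqrt:
  assumes "0 < a"
  shows "strict_antimono_on {a..b::nat} (\<lambda>i. 1 / sqrt (real i))"
  using assms by (auto simp: monotone_on_def intro!: divide_strict_left_mono)

section \<open>Sums over arcs, vertices and edges\<close>

context pair_graph
begin

lemma vdegree_eq_card_neighbours: "vdegree G v = card (neighbours G v)"
proof -
  have "out_arcs (with_proj G) v = Pair v ` neighbours G v"
    by (auto simp: out_arcs_def neighbours_def)
  then show ?thesis
    by (simp add: vdegree_def out_degree_def card_image inj_on_def)
qed

lemma finite_neighbours: "finite (neighbours G v)"
proof -
  have "neighbours G v \<subseteq> pverts G"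
    by (auto simp: neighbours_def dest: in_arcsD2)
  then show ?thesis
    using pair_finite_verts finite_subset by blast
qed

lemma sum_parcs_swap: "(\<Sum>(u,v)\<in>parcs G. f u v) = (\<Sum>(u,v)\<in>parcs G. f v u)"
  by (rule sum.reindex_bij_witness[where i = prod.swap and j = prod.swap])
    (auto intro: arcs_symmetric)

lemma sum_parcs_fst: "(\<Sum>(u,v)\<in>parcs G. f u) = (\<Sum>u\<in>pverts G. of_nat (vdegree G u) * f u)"
proof -
  have "parcs G = Sigma (pverts G) (neighbours G)"
    by (auto simp: neighbours_def dest: in_arcsD1)
  then have "(\<Sum>(u,v)\<in>parcs G. f u) = (\<Sum>u\<in>pverts G. \<Sum>v\<in>neighbours G u. f u)"
    by (simp only:) (rule sum.Sigma[symmetric], auto simp: pair_finite_verts finite_neighbours)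
  then show ?thesis
    by (simp add: vdegree_eq_card_neighbours)
qed

text \<open>Each edge is the image of exactly two arcs, which are distinct because there are no
  loops.\<close>

lemma sum_uedges_parcs:
  fixes f :: "'a set \<Rightarrow> real"
  shows "2 * (\<Sum>e\<in>uedges G. f e) = (\<Sum>(u,v)\<in>parcs G. f {u, v})"
proof -
  let ?h = "\<lambda>(u, v). {u, v}"
  have img: "uedges G = ?h ` parcs G"
    by (auto simp: uedges_def image_def)
  have fibre: "(\<Sum>p | p \<in> parcs G \<and> ?h p = e. f (?h p)) = 2 * f e" if e: "e \<in> uedges G" for e
  proof -
    obtain u v where uv: "e = {u, v}" "(u, v) \<in> parcs G"
      using e by (auto simp: uedges_def)
    then have "u \<noteq> v" "(v, u) \<in> parcs G"
      by (auto dest: no_loops' arcs_symmetric)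
    then have "{p \<in> parcs G. ?h p = e} = {(u, v), (v, u)}"
      using uv by (auto simp: doubleton_eq_iff)
    then show ?thesis
      using \<open>u \<noteq> v\<close> uv(1) by (simp add: insert_commute)
  qed
  have "(\<Sum>p\<in>parcs G. f (?h p)) = (\<Sum>e\<in>uedges G. \<Sum>p | p \<in> parcs G \<and> ?h p = e. f (?h p))"
    unfolding img by (rule sum.image_gen[OF pair_finite_arcs])
  also have "\<dots> = (\<Sum>e\<in>uedges G. 2 * f e)"
    by (rule sum.cong[OF refl fibre])
  finally show ?thesis
    by (simp add: sum_distrib_left case_prod_unfold)
qed

section \<open>Edges oriented by increasing degree\<close>

definition rising_arcs :: "('a \<times> 'a) set" where
  "rising_arcs = {(u, v) \<in> parcs G. vdegree G u < vdegree G v}"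

text \<open>The edge cut between the vertices of degree at most \<open>i\<close> and the rest, each
  edge taken once, in its upward orientation.\<close>

definition crossing_arcs :: "nat \<Rightarrow> ('a \<times> 'a) set" where
  "crossing_arcs i = {(u, v) \<in> parcs G. vdegree G u \<le> i \<and> i < vdegree G v}"

lemma finite_rising_arcs: "finite rising_arcs"
  and finite_crossing_arcs: "finite (crossing_arcs i)"
  by (auto simp: rising_arcs_def crossing_arcs_def intro: finite_subset[OF _ pair_finite_arcs])

text \<open>Arcs between equal degrees contribute nothing, and swapping the ends matches falling
  arcs with rising ones.\<close>

lemma sum_parcs_rising:
  fixes f :: "'a \<Rightarrow> 'a \<Rightarrow> real"
  assumes sym: "\<And>u v. f u v = f v u"
    and zero: "\<And>u v. vdegree G u = vdegree G v \<Longrightarrow> f u v = 0"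
  shows "(\<Sum>(u,v)\<in>parcs G. f u v) = 2 * (\<Sum>(u,v)\<in>rising_arcs. f u v)"
proof -
  let ?F = "{(u, v) \<in> parcs G. vdegree G v < vdegree G u}"
  have fin: "finite ?F"
    by (auto intro: finite_subset[OF _ pair_finite_arcs])
  have "(\<Sum>(u,v)\<in>parcs G. f u v) = (\<Sum>(u,v)\<in>rising_arcs \<union> ?F. f u v)"
    by (rule sum.mono_neutral_right[OF pair_finite_arcs])
      (auto simp: rising_arcs_def intro!: zero)
  also have "\<dots> = (\<Sum>(u,v)\<in>rising_arcs. f u v) + (\<Sum>(u,v)\<in>?F. f u v)"
    by (rule sum.union_disjoint[OF finite_rising_arcs fin]) (auto simp: rising_arcs_def)
  also have "(\<Sum>(u,v)\<in>?F. f u v) = (\<Sum>(u,v)\<in>rising_arcs. f u v)"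
    by (rule sum.reindex_bij_witness[where i = prod.swap and j = prod.swap])
      (auto simp: rising_arcs_def intro: arcs_symmetric sym)
  finally show ?thesis by simp
qed

section \<open>The Randic index as a defect from half the order\<close>

lemma randic_index_eq:
  assumes pos: "\<And>v. v \<in> pverts G \<Longrightarrow> 0 < vdegree G v"
  shows "randic_index G = real (card (pverts G)) / 2
    - 1/2 * (\<Sum>(u,v)\<in>rising_arcs. (1 / sqrt (vdegree G u) - 1 / sqrt (vdegree G v))\<^sup>2)"
proof -
  define x where "x v = 1 / sqrt (real (vdegree G v))" for v
  \<comment> \<open>A vertex \<open>u\<close> is the tail of \<open>vdegree G u\<close> arcs, each
    contributing the reciprocal of that degree, which is positive by \<open>pos\<close>.\<close>
  have "(\<Sum>(u,v)\<in>parcs G. (x u)\<^sup>2) = (\<Sum>v\<in>pverts G. 1)"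
    unfolding sum_parcs_fst
    by (rule sum.cong) (auto simp: x_def power_divide dest: pos)
  then have sq1: "(\<Sum>(u,v)\<in>parcs G. (x u)\<^sup>2) = card (pverts G)"
    by simp
  then have sq2: "(\<Sum>(u,v)\<in>parcs G. (x v)\<^sup>2) = card (pverts G)"
    by (subst sum_parcs_swap) simp
  have "2 * randic_index G
      = (\<Sum>(u,v)\<in>parcs G. 1 / sqrt (\<Prod>w\<in>{u, v}. real (vdegree G w)))"
    unfolding randic_index_def by (rule sum_uedges_parcs)
  \<comment> \<open>Without loops, the product over \<open>{u, v}\<close> really has two
    factors.\<close>
  also have "\<dots> = (\<Sum>(u,v)\<in>parcs G. x u * x v)"
    by (rule sum.cong) (auto simp: x_def real_sqrt_mult dest: no_loops')
  finally have R: "2 * randic_index G = (\<Sum>(u,v)\<in>parcs G. x u * x v)" .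
  have "2 * (\<Sum>(u,v)\<in>rising_arcs. (x u - x v)\<^sup>2) = (\<Sum>(u,v)\<in>parcs G. (x u - x v)\<^sup>2)"
    by (rule sum_parcs_rising[symmetric]) (auto simp: x_def power2_commute)
  also have "\<dots> = (\<Sum>(u,v)\<in>parcs G. (x u)\<^sup>2) + (\<Sum>(u,v)\<in>parcs G. (x v)\<^sup>2)
      - 2 * (\<Sum>(u,v)\<in>parcs G. x u * x v)"
    by (simp add: power2_diff sum.distrib sum_subtractf sum_distrib_left case_prod_unfold
        mult.assoc)
  also have "\<dots> = 2 * real (card (pverts G)) - 4 * randic_index G"
    using R sq1 sq2 by simp
  finally show ?thesis
    by (simp add: x_def)
qed

section \<open>Extreme degrees and the levels between them\<close>

lemma min_degree_le: "v \<in> pverts G \<Longrightarrow> min_degree G \<le> vdegree G v"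
  and le_max_degree: "v \<in> pverts G \<Longrightarrow> vdegree G v \<le> max_degree G"
  by (auto simp: min_degree_def max_degree_def pair_finite_verts)

lemma min_degree_attained:
  assumes "pverts G \<noteq> {}" obtains v where "v \<in> pverts G" "vdegree G v = min_degree G"
proof -
  have "min_degree G \<in> vdegree G ` pverts G"
    unfolding min_degree_def using assms pair_finite_verts by (intro Min_in) auto
  then show thesis
    using that by auto
qed

lemma max_degree_attained:
  assumes "pverts G \<noteq> {}" obtains v where "v \<in> pverts G" "vdegree G v = max_degree G"
proof -
  have "max_degree G \<in> vdegree G ` pverts G"
    unfolding max_degree_def using assms pair_finite_verts by (intro Max_in) auto
  then show thesis
    using that by auto
qed

text \<open>Double counting of the pairs of a rising arc and a level that it crosses.\<close>

lemma sum_rising_arcs_steps: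
  fixes c :: "nat \<Rightarrow> real"
  shows "(\<Sum>(u,v)\<in>rising_arcs. \<Sum>i=vdegree G u..<vdegree G v. c i)
    = (\<Sum>i=min_degree G..<max_degree G. real (card (crossing_arcs i)) * c i)"
proof -
  let ?I = "{min_degree G..<max_degree G}"
  let ?X = "\<lambda>e i. vdegree G (fst e) \<le> i \<and> i < vdegree G (snd e)"
  have level: "{vdegree G (fst e)..<vdegree G (snd e)} = {i \<in> ?I. ?X e i}"
    if "e \<in> rising_arcs" for e
    using that in_arcsD1[THEN min_degree_le] in_arcsD2[THEN le_max_degree]
    by (fastforce simp: rising_arcs_def)
  have cross: "{e \<in> rising_arcs. ?X e i} = crossing_arcs i" for i
    by (auto simp: rising_arcs_def crossing_arcs_def)
  have "(\<Sum>(u,v)\<in>rising_arcs. \<Sum>i=vdegree G u..<vdegree G v. c i)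
      = (\<Sum>e\<in>rising_arcs. sum c {i \<in> ?I. ?X e i})"
    by (rule sum.cong) (simp_all only: level case_prod_unfold)
  also have "\<dots> = (\<Sum>i\<in>?I. \<Sum>e | e \<in> rising_arcs \<and> ?X e i. c i)"
    by (rule sum.swap_restrict[OF finite_rising_arcs]) simp
  finally show ?thesis
    by (simp add: cross)
qed

section \<open>Connectivity and the crossing of levels\<close>

text \<open>As arcs are symmetric, connectivity gives a directed walk from \<open>u\<close> to
  \<open>w\<close>; some arc of it leaves \<open>S\<close>.\<close>

lemma connected_crosses:
  assumes conn: "connected (with_proj G)"
    and "u \<in> pverts G" "w \<in> pverts G" "u \<in> S" "w \<notin> S"
  obtains a b where "(a, b) \<in> parcs G" "a \<in> S" "b \<notin> S"
proof -
  have "strongly_connected (with_proj G)"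
    using symmetric_connected_imp_strongly_connected[OF pair_sym_arcs conn] .
  then have "u \<rightarrow>\<^sup>*\<^bsub>with_proj G\<^esub> w"
    using assms(2,3) by (auto simp: strongly_connected_def)
  then have "(u, w) \<in> (parcs G)\<^sup>*"
    using reachable_rtranclI by force
  then show thesis
    using assms(4,5) that by (induction rule: rtrancl_induct) blast+
qed

lemma card_crossing_arcs_ge_1:
  assumes conn: "connected (with_proj G)"
    and i: "i \<in> {min_degree G..<max_degree G}"
  shows "1 \<le> card (crossing_arcs i)"
proof -
  have ne: "pverts G \<noteq> {}"
    using conn by (auto simp: connected_def strongly_connected_def)
  obtain u where u: "u \<in> pverts G" "vdegree G u = min_degree G"
    using min_degree_attained[OF ne] .
  obtain w where w: "w \<in> pverts G" "vdegree G w = max_degree G"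
    using max_degree_attained[OF ne] .
  obtain a b where "(a, b) \<in> parcs G" "vdegree G a \<le> i" "\<not> vdegree G b \<le> i"
    \<comment> \<open>A vertex of minimum degree lies in this set; one of maximum degree does not,
      since \<open>i < max_degree G\<close>.\<close>
    using connected_crosses[OF conn u(1) w(1), of "{v. vdegree G v \<le> i}"] u(2) w(2) i by auto
  then have "(a, b) \<in> crossing_arcs i"
    by (simp add: crossing_arcs_def)
  then have "crossing_arcs i \<noteq> {}"
    by blast
  then show ?thesis
    using finite_crossing_arcs[of i] by (simp add: Suc_le_eq card_gt_0_iff)
qed

text \<open>The sole arc crossing level \<open>i\<close> climbs by one, so it runs from degree
  \<open>i\<close> to \<open>i + 1\<close>. Every arc between these two degree classes crosses level
  \<open>i\<close> and hence is this one, which gives existence and uniqueness together.\<close>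

lemma ex1_neighbour_in_next_level:
  assumes card: "card (crossing_arcs i) = 1"
    and step: "\<And>u v. (u, v) \<in> rising_arcs \<Longrightarrow> vdegree G v = Suc (vdegree G u)"
  shows "\<exists>!v. v \<in> verts_of_degree G i \<and> card (neighbours G v \<inter> verts_of_degree G (i + 1)) = 1"
proof -
  obtain a b where ab: "crossing_arcs i = {(a, b)}"
    using card by (metis card_1_singletonE surj_pair)
  then have ab_arc: "(a, b) \<in> parcs G" and "vdegree G a \<le> i" "i < vdegree G b"
    by (auto simp: crossing_arcs_def)
  moreover from this have "vdegree G b = Suc (vdegree G a)"
    by (intro step) (auto simp: rising_arcs_def)
  ultimately have deg: "vdegree G a = i" "vdegree G b = Suc i"
    by auto
  have only: "u = a \<and> v = b"
    if "u \<in> verts_of_degree G i" "v \<in> neighbours G u \<inter> verts_of_degree G (i + 1)" for u v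
  proof -
    have "(u, v) \<in> crossing_arcs i"
      using that by (auto simp: crossing_arcs_def verts_of_degree_def neighbours_def)
    then show ?thesis
      using ab by simp
  qed
  have a: "a \<in> verts_of_degree G i"
    using deg ab_arc in_arcsD1 by (auto simp: verts_of_degree_def)
  have "b \<in> neighbours G a \<inter> verts_of_degree G (i + 1)"
    using deg ab_arc in_arcsD2 by (auto simp: verts_of_degree_def neighbours_def)
  then have "neighbours G a \<inter> verts_of_degree G (i + 1) = {b}"
    using only[OF a] by blast
  then have "card (neighbours G a \<inter> verts_of_degree G (i + 1)) = 1"
    by simp
  moreover have "v = a"
    if "v \<in> verts_of_degree G i" "card (neighbours G v \<inter> verts_of_degree G (i + 1)) = 1" for v
    using that only by (metis card_1_singletonE singletonI)
  ultimately show ?thesis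
    using a by blast
qed

end

theorem theorem2p3:
  fixes G :: "'a pair_pre_digraph" and n d D :: nat
  assumes "0 < d" and "d < D"
    and "pair_graph G"
    and "Digraph_Component.connected (with_proj G)"
    and "card (pverts G) = n"
    and "min_degree G = d" and "max_degree G = D"
  shows "randic_index G
           \<le> real n / 2 - (\<Sum>i=d..D-1. 1/2 * (1 / sqrt (real i) - 1 / sqrt (real (i + 1)))^2)
       \<and> (randic_index G
           = real n / 2 - (\<Sum>i=d..D-1. 1/2 * (1 / sqrt (real i) - 1 / sqrt (real (i + 1)))^2)
           \<longrightarrow> G \<in> extremal_family d D)"
proof -
  interpret pair_graph G by fact
  define y where "y i = 1 / sqrt (real i)" for i :: nat
  define c where "c i = (y i - y (Suc i))\<^sup>2" for i
  \<comment> \<open>The bound comes from the chain \<open>(\<Sum>i=d..<D. c i) \<le> sum s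
    rising_arcs \<le> sum q rising_arcs\<close>: the first step uses connectivity, the second
    compares arc by arc.\<close>
  define s where "s = (\<lambda>(u, v). \<Sum>i=vdegree G u..<vdegree G v. c i)"
  define q where "q = (\<lambda>(u, v). (y (vdegree G u) - y (vdegree G v))\<^sup>2)"
  have pos: "0 < vdegree G v" if "v \<in> pverts G" for v
    using min_degree_le[OF that] assms by simp
  have levels: "{d..D-1} = {d..<D}"
    using \<open>d < D\<close> by auto
  have c_pos: "0 < c i" if "i \<in> {d..<D}" for i
    using strict_antimono_inverse_sqrt[of i "Suc i"] that \<open>0 < d\<close>
    by (auto simp: c_def y_def monotone_on_def)
  have s_q: "s (u, v) \<le> q (u, v) \<and> (Suc (vdegree G u) < vdegree G v \<longrightarrow> s (u, v) < q (u, v))"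
    if "(u, v) \<in> rising_arcs" for u v
  proof -
    have "0 < vdegree G u" "vdegree G u < vdegree G v"
      using that pos in_arcsD1 by (auto simp: rising_arcs_def)
    then show ?thesis
      using sum_squared_steps[OF _ strict_antimono_inverse_sqrt]
      by (simp add: s_def q_def c_def y_def)
  qed
  have R: "randic_index G = real n / 2 - 1/2 * sum q rising_arcs"
    using randic_index_eq[OF pos] \<open>card (pverts G) = n\<close> by (simp add: q_def y_def)
  have bound: "(\<Sum>i=d..D-1. 1/2 * (1 / sqrt (real i) - 1 / sqrt (real (i + 1)))^2)
      = 1/2 * (\<Sum>i=d..<D. c i)"
    unfolding levels by (simp add: sum_distrib_left c_def y_def)
  have sum_s: "sum s rising_arcs = (\<Sum>i=d..<D. real (card (crossing_arcs i)) * c i)"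
    using sum_rising_arcs_steps[of c] assms by (simp add: s_def)
  have card_ge: "1 \<le> card (crossing_arcs i)" if "i \<in> {d..<D}" for i
    using card_crossing_arcs_ge_1 that assms by simp
  have c_le: "c i \<le> real (card (crossing_arcs i)) * c i" if "i \<in> {d..<D}" for i
    using card_ge[OF that] c_pos[OF that] by (simp add: mult_le_cancel_right1)
  have le1: "(\<Sum>i=d..<D. c i) \<le> sum s rising_arcs"
    unfolding sum_s by (rule sum_mono[OF c_le])
  have le2: "sum s rising_arcs \<le> sum q rising_arcs"
    using s_q by (intro sum_mono) auto
  have "G \<in> extremal_family d D" if eq: "sum q rising_arcs = (\<Sum>i=d..<D. c i)"
  proof -
    \<comment> \<open>Equality of the outer terms of the chain forces equality in both steps, and
      then term by term.\<close>
    have eq_c: "(\<Sum>i=d..<D. c i) = (\<Sum>i=d..<D. real (card (crossing_arcs i)) * c i)"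
      using le1 le2 eq sum_s by linarith
    have eq_q: "sum s rising_arcs = sum q rising_arcs"
      using le1 le2 eq by linarith
    \<comment> \<open>The strictly positive weight \<open>c i\<close> can be cancelled.\<close>
    have card: "card (crossing_arcs i) = 1" if "i \<in> {d..<D}" for i
      using sum_mono_inv[OF eq_c c_le that] c_pos[OF that] by simp
    have step: "vdegree G v = Suc (vdegree G u)" if "(u, v) \<in> rising_arcs" for u v
    proof -
      have "s (u, v) = q (u, v)"
        using s_q by (intro sum_mono_inv[OF eq_q _ that finite_rising_arcs]) auto
      \<comment> \<open>A jump of two or more degrees would make the inequality for this arc
        strict.\<close>
      then have "\<not> Suc (vdegree G u) < vdegree G v"
        using s_q[OF that] by simp
      then show ?thesis
        using that by (simp add: rising_arcs_def)
    qed
    have "pverts G \<noteq> {}"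
      using assms(4) by (auto simp: connected_def strongly_connected_def)
    moreover have "\<forall>i\<in>{d..D-1}. \<exists>!v. v \<in> verts_of_degree G i \<and>
        card (neighbours G v \<inter> verts_of_degree G (i + 1)) = 1"
      unfolding levels by (intro ballI ex1_neighbour_in_next_level card step)
    ultimately show ?thesis
      unfolding extremal_family_def using assms by simp
  qed
  then show ?thesis
    unfolding bound R using le1 le2 by auto
qed

end
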